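(* Let $n\ge 2$ be an integer, let $t\in\mathbb{Z}\setminus\{0\}$, and let $P(x)=c_0+c_1x+\ldots+c_dx^d\in\mathbb{Z}[x]$ be a polynomial such that $$c_0=(-t)^n\quad\text{and}\quad x^dP\big((-t)^{n-1}x^{-1}\big)=C\cdot P(x)\ \text{ for some non-zero constant } C.$$ Call an integer $(n+1)$-tuple $(y_0,y_1,\ldots,y_n)$ a solution if $$P\big(K^{(t)}_{n-1}(y_1,\ldots,y_{n-1})\big)=K^{(t)}_n(y_0,\ldots,y_{n-1})\,K^{(t)}_n(y_1,\ldots,y_n).$$ Assume that $(x_0,\ldots,x_n)\in\mathbb{Z}^{n+1}$ is a solution such that each term $x_0,\ldots,x_n$ is coprime with $t$. Then there exist $x_{n+1}\in\mathbb{Z}$ and $x_{-1}\in\mathbb{Z}$ such that $(x_1,\ldots,x_{n+1})$ and $(x_{-1},x_0,\ldots,x_{n-1})$ are also solutions. Moreover, the value $x_{n+1}$ (respectively $x_{-1}$) is uniquely defined by $(x_0,\ldots,x_n)$ unless $K^{(t)}_{n-1}(x_2,\ldots,x_n)=0$ (respectively $K^{(t)}_{n-1}(x_0,\ldots,x_{n-2})=0$). In the latter case, $(x_1,\ldots,x_{n+1})$ (respectively $(x_{-1},\ldots,x_{n-1})$) is a solution for any integer $x_{n+1}$ (respectively $x_{-1}$).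
   Context: For $t\in\mathbb{Z}\setminus\{0\}$ the generalised continuants $K^{(t)}_k$ are the polynomials in $k$ variables defined by $K^{(t)}_0():=1$, $K^{(t)}_1(x_1):=x_1$ and $$K^{(t)}_{k+1}(x_1,\ldots,x_{k+1})=x_{k+1}K^{(t)}_k(x_1,\ldots,x_k)+t\,K^{(t)}_{k-1}(x_1,\ldots,x_{k-1}).$$
   Formalization: Uniqueness of x_{n+1} (resp. x_{-1}) is stated under the additional condition K_n(x_1,…,x_n)≠0 (resp. K_n(x_0,…,x_{n-1})≠0), since it fails otherwise: n=2, t=-1, P=(x-1)^2, (0,1,1) has K_1(x_2)=1, yet (1,1,z) is a solution for every z. *)

theory Defs
  imports Complex_Main "HOL-Computational_Algebra.Polynomial"
begin

text \<open>
  The recursion for generalised continuants peels off the last variable, so it is run on the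
  reversed list of arguments; the three equations \<open>continuant_Nil\<close>, \<open>continuant_single\<close> and
  \<open>continuant_snoc\<close> below are the usual defining equations. The number of variables is the
  length of the list.
\<close>

fun continuant_rev :: "int \<Rightarrow> int list \<Rightarrow> int" where
  "continuant_rev t [] = 1"
| "continuant_rev t [x] = x"
| "continuant_rev t (z # y # xs) = z * continuant_rev t (y # xs) + t * continuant_rev t xs"

definition continuant :: "int \<Rightarrow> int list \<Rightarrow> int" where
  "continuant t xs = continuant_rev t (rev xs)"

lemma continuant_Nil: "continuant t [] = 1"
  by (simp add: continuant_def)

lemma continuant_single: "continuant t [x] = x"
  by (simp add: continuant_def)

lemma continuant_snoc:
  "continuant t (xs @ [y, z]) = z * continuant t (xs @ [y]) + t * continuant t xs"
  by (simp add: continuant_def)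

text \<open>
  For \<open>ys = [y\<^sub>0, \<dots>, y\<^sub>n]\<close> the three lists below are \<open>[y\<^sub>1, \<dots>, y\<^sub>n\<^sub>-\<^sub>1]\<close>,
  \<open>[y\<^sub>0, \<dots>, y\<^sub>n\<^sub>-\<^sub>1]\<close> and \<open>[y\<^sub>1, \<dots>, y\<^sub>n]\<close>.
\<close>

definition is_solution :: "nat \<Rightarrow> int \<Rightarrow> int poly \<Rightarrow> int list \<Rightarrow> bool" where
  "is_solution n t P ys \<longleftrightarrow>
     length ys = n + 1 \<and>
     poly P (continuant t (butlast (tl ys))) = continuant t (butlast ys) * continuant t (tl ys)"

text \<open>
  If the continuant of \<open>x\<^sub>1, \<dots>, x\<^sub>n\<close> vanishes, the next entry \<open>x\<^sub>n\<^sub>+\<^sub>1\<close> is not determined, even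
  when the continuant of \<open>x\<^sub>2, \<dots>, x\<^sub>n\<close> does not vanish. An example is \<open>n = 2\<close>, \<open>t = -1\<close>,
  \<open>P = (x - 1)\<^sup>2\<close> (self-reciprocal, constant term \<open>(-t)\<^sup>n = 1\<close>) and the solution \<open>(0, 1, 1)\<close>.
\<close>

lemma next_entry_not_unique:
  defines "P \<equiv> [:1, -2, 1:] :: int poly"
  shows "coeff P 0 = (- (-1)) ^ 2"
    and "x \<noteq> 0 \<Longrightarrow> x ^ 2 * poly (map_poly of_int P) ((- of_int (-1)) ^ (2 - 1) / x)
                  = 1 * poly (map_poly of_int P) (x :: complex)"
    and "is_solution 2 (-1) P [0, 1, 1]"
    and "continuant (-1) (drop 2 [0, 1, 1]) \<noteq> 0"
    and "is_solution 2 (-1) P (tl [0, 1, 1] @ [z])"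
  unfolding P_def
  by (simp_all add: is_solution_def continuant_def map_poly_pCons field_simps power2_eq_square)

end

theory Submission
  imports Defs
begin

text \<open>
  Write \<open>K\<close> for the continuant, \<open>s = (-t)\<^bsup>n-1\<^esup>\<close>, and, for a solution \<open>(x\<^sub>0, \<dots>, x\<^sub>n)\<close>,
  \<open>a = K(x\<^sub>1, \<dots>, x\<^sub>n\<^sub>-\<^sub>1)\<close>, \<open>b = K(x\<^sub>2, \<dots>, x\<^sub>n)\<close>, \<open>B = K(x\<^sub>1, \<dots>, x\<^sub>n)\<close> and
  \<open>D = K(x\<^sub>2, \<dots>, x\<^sub>n\<^sub>-\<^sub>1)\<close>. By the recursion, \<open>z\<close> continues the solution to the right exactly if
  \<open>P(b) = B (z b + t D)\<close>. So \<open>B\<close> has to divide \<open>P(b)\<close>, and the quotient has to be congruent to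
  \<open>t D\<close> modulo \<open>b\<close>.

  Everything rests on Euler's identity \<open>a b - B D = s\<close> (\<open>continuant_euler\<close>). Modulo every prime
  divisor of \<open>t\<close> a continuant is the product of its entries, so all continuants in question are
  coprime with \<open>t\<close> (\<open>coprime_continuant\<close>), and Euler's identity then makes \<open>b\<close> and \<open>B\<close> coprime.

  \<^item> Modulo \<open>B\<close>, the numbers \<open>a\<close> and \<open>b\<close> are inverse to each other up to the factor \<open>s\<close>. The given
    solution says that \<open>B\<close> divides \<open>P(a)\<close>, and the self-reciprocity of \<open>P\<close> under \<open>x \<mapsto> s/x\<close>
    turns this into \<open>B\<close> dividing \<open>P(b)\<close>. The constant \<open>C\<close> does no harm: comparing the
    coefficients of \<open>x\<^sup>d\<close> gives \<open>C c\<^sub>d = c\<^sub>0 = (-t)\<^sup>n\<close>, which is coprime with \<open>B\<close>.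
  \<^item> Modulo \<open>b\<close>, we have \<open>P(b) \<equiv> c\<^sub>0 = (-t)\<^sup>n = - t s \<equiv> B t D\<close>, and \<open>B\<close> can be cancelled.

  These divisibility arguments include the degenerate cases \<open>b = 0\<close> and \<open>B = 0\<close>. When \<open>b = 0\<close>,
  the entry \<open>z\<close> drops out of the equation \<open>P(b) = B (z b + t D)\<close>, so that one continuation makes
  every \<open>z\<close> a continuation; when \<open>b\<close> and \<open>B\<close> are both non-zero, \<open>z\<close> is determined. Continuation to
  the left is continuation of the reversed tuple to the right, since continuants are invariant
  under reversal of their entries (\<open>continuant_rev_list\<close>).
\<close>

section \<open>Continuants\<close>

lemma continuant_rev_snoc:
  "continuant_rev t (xs @ [y, z]) = z * continuant_rev t (xs @ [y]) + t * continuant_rev t xs"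
  by (induction t xs rule: continuant_rev.induct) (simp_all add: algebra_simps)

text \<open>
  The recursion may be run from either end of the list: \<open>continuant_rev\<close> satisfies the
  recursion at the far end too, and both recursions have the same initial values.
\<close>

lemma continuant_eq_continuant_rev: "continuant t xs = continuant_rev t xs"
  unfolding continuant_def
proof (induction t xs rule: continuant_rev.induct)
  case (3 t z y xs)
  then show ?case
    using continuant_rev_snoc[of t "rev xs" y z] by simp
qed simp_all

lemma continuant_rev_list: "continuant t (rev xs) = continuant t xs"
  by (metis continuant_def continuant_eq_continuant_rev)

lemma continuant_Cons:
  "continuant t (x # y # xs) = x * continuant t (y # xs) + t * continuant t xs"
  by (simp add: continuant_eq_continuant_rev)

text \<open>
  The matrices with rows \<open>(x, t)\<close> and \<open>(1, 0)\<close>, one for each entry \<open>x\<close> of the list, have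
  determinant \<open>-t\<close>, and the entries of their product are the four continuants here, two of them
  multiplied by \<open>t\<close>. The identity is multiplicativity of the determinant, with one factor
  \<open>-t\<close> cancelled; in the induction each entry contributes its factor \<open>-t\<close>.
\<close>

lemma continuant_euler:
  "continuant t (u # ys) * continuant t (ys @ [v]) - continuant t (u # ys @ [v]) * continuant t ys
     = (- t) ^ (length ys + 1)"
proof (induction ys arbitrary: u)
  case Nil
  show ?case
    by (simp add: continuant_eq_continuant_rev)
next
  case (Cons w ws)
  have "continuant t (u # w # ws) * continuant t ((w # ws) @ [v])
          - continuant t (u # (w # ws) @ [v]) * continuant t (w # ws)
        = (- t) * (continuant t (w # ws) * continuant t (ws @ [v])
          - continuant t (w # ws @ [v]) * continuant t ws)"
    by (simp add: continuant_Cons algebra_simps)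
  then show ?case
    by (simp add: Cons.IH)
qed

text \<open>Modulo \<open>t\<close> the second term of the recursion disappears, and the product of the entries is left.\<close>

lemma coprime_continuant:
  assumes "\<forall>x \<in> set xs. coprime x t"
  shows "coprime (continuant t xs) t"
proof -
  have shift: "coprime (m + t * k) t \<longleftrightarrow> coprime m t" for m k :: int
    using gcd_add_mult[of t k m]
    by (simp add: coprime_iff_gcd_eq_1 gcd.commute add.commute mult.commute)
  show ?thesis
    using assms
  proof (induction xs rule: induct_list012)
    case (3 x y zs)
    then show ?case
      by (simp add: continuant_Cons shift)
  qed (simp_all add: continuant_Nil continuant_single)
qed

section \<open>Self-reciprocal polynomials\<close>

lemma poly_eq_sum_atMost:
  fixes p :: "'a :: comm_semiring_1 poly"
  assumes "degree p \<le> d"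
  shows "poly p x = (\<Sum>i\<le>d. coeff p i * x ^ i)"
  unfolding poly_altdef
  using assms by (intro sum.mono_neutral_left) (auto simp: coeff_eq_0)

text \<open>
  For non-zero \<open>y\<close> the sum on the left is \<open>y\<^sup>d p(s/y)\<close>. Multiplying by the coefficient
  of index \<open>d\<close> removes \<open>C\<close> in favour of an integer, because that coefficient times \<open>C\<close> is the constant term.
\<close>

lemma self_reciprocal_integer_identity:
  fixes p :: "int poly" and s y :: int and C :: complex
  assumes deg: "degree p \<le> d"
    and recip: "\<And>x :: complex. x \<noteq> 0 \<Longrightarrow>
           x ^ d * poly (map_poly of_int p) (of_int s / x) = C * poly (map_poly of_int p) x"
  shows "coeff p d * (\<Sum>i\<le>d. coeff p i * s ^ i * y ^ (d - i)) = coeff p 0 * poly p y"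
proof -
  define p' :: "complex poly" where "p' = map_poly of_int p"
  define q :: "int poly" where "q = (\<Sum>i\<le>d. monom (coeff p i * s ^ i) (d - i))"
  define q' :: "complex poly" where "q' = map_poly of_int q"
  have coeff_p': "coeff p' i = of_int (coeff p i)" for i
    by (simp add: p'_def coeff_map_poly)
  have deg': "degree p' \<le> d"
    using deg by (simp add: p'_def degree_map_poly)
  have q'_eq: "q' = (\<Sum>i\<le>d. monom (coeff p' i * of_int s ^ i) (d - i))"
    by (rule poly_eqI)
      (simp add: q'_def q_def coeff_map_poly coeff_sum coeff_p' of_int_sum if_distrib cong: if_cong)
  have agree: "poly q' x = poly (smult C p') x" if "x \<noteq> 0" for x
  proof -
    have "poly q' x = (\<Sum>i\<le>d. coeff p' i * of_int s ^ i * x ^ (d - i))"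
      by (simp add: q'_eq poly_sum poly_monom)
    also have "\<dots> = x ^ d * poly p' (of_int s / x)"
      unfolding poly_eq_sum_atMost[OF deg'] sum_distrib_left
      using that by (intro sum.cong) (auto simp: power_diff field_simps)
    finally show ?thesis
      using recip[OF that] by (simp add: p'_def)
  qed
  \<comment> \<open>The two polynomials agree on the infinite set of non-zero numbers.\<close>
  have q'_smult: "q' = smult C p'"
  proof (rule ccontr)
    assume "q' \<noteq> smult C p'"
    then have "finite {x. poly (q' - smult C p') x = 0}"
      by (intro poly_roots_finite) simp
    moreover have "UNIV - {0} \<subseteq> {x. poly (q' - smult C p') x = 0}"
      using agree by auto
    ultimately have "finite (UNIV - {0 :: complex})"
      by (rule rev_finite_subset)
    then show False
      by (simp add: infinite_UNIV_char_0)
  qed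
  have "coeff q d = (\<Sum>i\<le>d. if i = 0 then coeff p i * s ^ i else 0)"
    unfolding q_def coeff_sum by (intro sum.cong) auto
  then have "coeff q d = coeff p 0"
    by simp
  moreover have coeff_q: "of_int (coeff q k) = C * of_int (coeff p k)" for k
    using arg_cong[OF q'_smult, of "\<lambda>r. coeff r k"]
    by (simp add: q'_def coeff_map_poly coeff_p')
  ultimately have C_lead: "of_int (coeff p 0) = C * of_int (coeff p d)"
    by metis
  have "smult (coeff p d) q = smult (coeff p 0) p"
  proof (rule poly_eqI)
    fix k
    have "(of_int (coeff p d * coeff q k) :: complex) = of_int (coeff p 0 * coeff p k)"
      by (simp add: C_lead coeff_q)
    then show "coeff (smult (coeff p d) q) k = coeff (smult (coeff p 0) p) k"
      by (simp only: of_int_eq_iff coeff_smult)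
  qed
  then have "coeff p d * poly q y = coeff p 0 * poly p y"
    by (metis poly_smult)
  then show ?thesis
    by (simp add: q_def poly_sum poly_monom)
qed

text \<open>
  Modulo \<open>m\<close>, the value \<open>b\<^sup>d p(a)\<close> equals \<open>b\<^sup>d p(s/b)\<close>, a polynomial in \<open>b\<close>, since \<open>a b\<close> is
  congruent to \<open>s\<close>. By
  self-reciprocity the latter is \<open>C p(b)\<close>, and multiplied by the coefficient of index \<open>d\<close> it
  becomes \<open>p(b)\<close> times the constant term, which is invertible modulo \<open>m\<close>.
\<close>

lemma self_reciprocal_dvd_transfer:
  fixes p :: "int poly" and s a b m :: int and C :: complex
  assumes deg: "degree p \<le> d"
    and recip: "\<And>x :: complex. x \<noteq> 0 \<Longrightarrow>
           x ^ d * poly (map_poly of_int p) (of_int s / x) = C * poly (map_poly of_int p) x"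
    and inverse: "m dvd a * b - s"
    and dvd: "m dvd poly p a"
    and cop: "coprime m (coeff p 0)"
  shows "m dvd poly p b"
proof -
  have "m dvd (a * b) ^ i - s ^ i" for i
    unfolding power_diff_sumr2 using inverse by (rule dvd_mult2)
  then have "m dvd (\<Sum>i\<le>d. coeff p i * b ^ (d - i) * ((a * b) ^ i - s ^ i))"
    by (intro dvd_sum dvd_mult)
  also have "\<dots> = b ^ d * poly p a - (\<Sum>i\<le>d. coeff p i * s ^ i * b ^ (d - i))"
  proof -
    have "b ^ d * (coeff p i * a ^ i) = coeff p i * b ^ (d - i) * (a * b) ^ i" if "i \<le> d" for i
    proof -
      have "b ^ d = b ^ (d - i) * b ^ i"
        using that by (simp flip: power_add)
      then show ?thesis
        by (simp only: power_mult_distrib mult_ac)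
    qed
    then have "b ^ d * poly p a = (\<Sum>i\<le>d. coeff p i * b ^ (d - i) * (a * b) ^ i)"
      unfolding poly_eq_sum_atMost[OF deg] sum_distrib_left by (intro sum.cong) auto
    then show ?thesis
      by (simp add: right_diff_distrib sum_subtractf mult_ac)
  qed
  finally have "m dvd (\<Sum>i\<le>d. coeff p i * s ^ i * b ^ (d - i))"
    using dvd by (simp add: dvd_diff_right_iff)
  then have "m dvd coeff p d * (\<Sum>i\<le>d. coeff p i * s ^ i * b ^ (d - i))"
    by (rule dvd_mult)
  also have "\<dots> = coeff p 0 * poly p b"
    by (rule self_reciprocal_integer_identity[OF deg]) (rule recip)
  finally show ?thesis
    using cop by (simp add: coprime_dvd_mult_right_iff)
qed

lemma dvd_poly_minus_coeff_0:
  fixes p :: "'a :: comm_ring_1 poly"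
  shows "x dvd poly p x - coeff p 0"
  by (cases p) simp

section \<open>Continuing a solution\<close>

lemma is_solution_rev: "is_solution n t P (rev xs) \<longleftrightarrow> is_solution n t P xs"
proof -
  have "butlast (rev xs) = rev (tl xs)"
    by (rule butlast_rev)
  moreover have tl_rev: "tl (rev xs) = rev (butlast xs)"
    by (metis butlast_rev rev_rev_ident)
  moreover from tl_rev have "butlast (tl (rev xs)) = rev (butlast (tl xs))"
    by (simp add: butlast_rev butlast_tl)
  ultimately show ?thesis
    by (simp add: is_solution_def continuant_rev_list mult.commute)
qed

lemma is_solution_snoc_iff:
  assumes "length ys + 2 = n"
  shows "is_solution n t P (u # ys @ [v, z]) \<longleftrightarrow>
    poly P (continuant t (ys @ [v]))
      = continuant t (u # ys @ [v]) * (z * continuant t (ys @ [v]) + t * continuant t ys)"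
  using assms by (auto simp: is_solution_def butlast_append continuant_snoc)

text \<open>
  The equation for \<open>z\<close> is \<open>P(b) = B (z b + t D)\<close> with \<open>B\<close> and \<open>b\<close> coprime. Solvability is the
  divisibility of \<open>P(b)\<close> by \<open>B\<close> and of the quotient minus \<open>t D\<close> by \<open>b\<close>; the coefficient of \<open>z\<close>
  is \<open>B b\<close>, and this decides between uniqueness and freedom.
\<close>

theorem solution_continues_right:
  fixes C :: complex
  assumes "n \<ge> 2"
    and deg: "degree P \<le> d"
    and coeff_0: "coeff P 0 = (- t) ^ n"
    and recip: "\<And>x :: complex. x \<noteq> 0 \<Longrightarrow>
           x ^ d * poly (map_poly of_int P) ((- of_int t) ^ (n - 1) / x)
             = C * poly (map_poly of_int P) x"
    and sol: "is_solution n t P xs"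
    and cop: "\<forall>x \<in> set xs. coprime x t"
  shows "\<exists>z. is_solution n t P (tl xs @ [z])"
    and "continuant t (drop 2 xs) \<noteq> 0 \<Longrightarrow> continuant t (tl xs) \<noteq> 0 \<Longrightarrow>
           \<exists>!z. is_solution n t P (tl xs @ [z])"
    and "continuant t (drop 2 xs) = 0 \<Longrightarrow> is_solution n t P (tl xs @ [z])"
proof -
  have "length xs = n + 1"
    using sol by (simp add: is_solution_def)
  then obtain x0 u ys v where xs: "xs = x0 # u # ys @ [v]" and len: "length ys + 2 = n"
    using \<open>n \<ge> 2\<close>
    by (cases xs; cases "tl xs"; cases "tl (tl xs)" rule: rev_cases) auto
  define a b B D where "a = continuant t (u # ys)" and "b = continuant t (ys @ [v])"
    and "B = continuant t (u # ys @ [v])" and "D = continuant t ys"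
  define s where "s = (- t) ^ (n - 1)"
  have continues_iff: "is_solution n t P (tl xs @ [z]) \<longleftrightarrow> poly P b = B * (z * b + t * D)" for z
    using is_solution_snoc_iff[OF len, of t P u v z] by (simp add: xs b_def B_def D_def)
  have tl_xs: "continuant t (tl xs) = B" and drop_xs: "continuant t (drop 2 xs) = b"
    by (simp_all add: xs b_def B_def)
  have euler: "a * b - B * D = s"
    using continuant_euler[of t u ys v] len by (auto simp: a_def b_def B_def D_def s_def)
  have cop_Bt: "coprime B t"
    unfolding B_def using cop by (intro coprime_continuant) (auto simp: xs)
  have cop_Bb: "coprime B b"
  proof (rule coprimeI)
    fix k assume "k dvd B" "k dvd b"
    then have "k dvd s"
      by (simp flip: euler)
    moreover have "coprime B s"
      using cop_Bt by (simp add: s_def)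
    ultimately show "is_unit k"
      using \<open>k dvd B\<close> coprime_common_divisor by blast
  qed
  have "B dvd poly P a"
    using sol by (simp add: is_solution_def xs a_def B_def butlast_append)
  moreover have "B dvd a * b - s"
    by (simp flip: euler)
  moreover have "coprime B (coeff P 0)"
    using cop_Bt by (simp add: coeff_0)
  ultimately have "B dvd poly P b"
    using self_reciprocal_dvd_transfer[OF deg, of s C B a b] recip by (simp add: s_def)
  then obtain w where w: "poly P b = B * w" ..
  have "coeff P 0 = - t * s"
    using len by (auto simp: coeff_0 s_def)
  \<comment> \<open>Euler's identity turns the constant term into \<open>B t D\<close> modulo \<open>b\<close>.\<close>
  then have "poly P b - coeff P 0 = B * (w - t * D) + b * (t * a)"
    by (simp add: w algebra_simps flip: euler)
  then have "b dvd B * (w - t * D)"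
    using dvd_poly_minus_coeff_0[of b P] by (simp add: dvd_add_left_iff)
  then have "b dvd w - t * D"
    using cop_Bb by (simp add: coprime_dvd_mult_right_iff coprime_commute)
  then obtain z0 where "w - t * D = b * z0" ..
  then have z0: "poly P b = B * (z0 * b + t * D)"
    by (simp add: w algebra_simps)
  show "\<exists>z. is_solution n t P (tl xs @ [z])"
    using z0 by (auto simp: continues_iff)
  show "\<exists>!z. is_solution n t P (tl xs @ [z])"
    if "continuant t (drop 2 xs) \<noteq> 0" "continuant t (tl xs) \<noteq> 0"
    using that unfolding continues_iff tl_xs drop_xs
    by (intro ex1I[of _ z0]) (auto simp: z0)
  show "is_solution n t P (tl xs @ [z])" if "continuant t (drop 2 xs) = 0"
    using that z0 by (simp add: continues_iff drop_xs)
qed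

theorem theorem1:
  fixes n d :: nat and t :: int and P :: "int poly" and C :: complex and xs :: "int list"
  assumes "n \<ge> 2"
    and "t \<noteq> 0"
    and "degree P \<le> d"
    and "coeff P 0 = (- t) ^ n"
    and "C \<noteq> 0"
    and "\<And>x :: complex. x \<noteq> 0 \<Longrightarrow>
           x ^ d * poly (map_poly of_int P) ((- of_int t) ^ (n - 1) / x)
             = C * poly (map_poly of_int P) x"
    and "is_solution n t P xs"
    and "\<forall>x \<in> set xs. coprime x t"
  shows "(\<exists>z. is_solution n t P (tl xs @ [z])) \<and>
         (\<exists>z. is_solution n t P (z # butlast xs)) \<and>
         (continuant t (drop 2 xs) \<noteq> 0 \<and> continuant t (tl xs) \<noteq> 0 \<longrightarrow>
            (\<exists>!z. is_solution n t P (tl xs @ [z]))) \<and>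
         (continuant t (take (n - 1) xs) \<noteq> 0 \<and> continuant t (butlast xs) \<noteq> 0 \<longrightarrow>
            (\<exists>!z. is_solution n t P (z # butlast xs))) \<and>
         (continuant t (drop 2 xs) = 0 \<longrightarrow>
            (\<forall>z. is_solution n t P (tl xs @ [z]))) \<and>
         (continuant t (take (n - 1) xs) = 0 \<longrightarrow>
            (\<forall>z. is_solution n t P (z # butlast xs)))"
proof -
  have len: "length xs = n + 1"
    using assms(7) by (simp add: is_solution_def)
  have rev_sol: "is_solution n t P (rev xs)" and rev_cop: "\<forall>x \<in> set (rev xs). coprime x t"
    using assms(7,8) by (simp_all add: is_solution_rev)
  have reversed: "is_solution n t P (tl (rev xs) @ [z]) \<longleftrightarrow> is_solution n t P (z # butlast xs)" for z
    using is_solution_rev[of n t P "z # butlast xs"] by (metis butlast_rev rev.simps(2) rev_rev_ident)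
  have "drop 2 (rev xs) = rev (take (n - 1) xs)"
    using len \<open>n \<ge> 2\<close> by (simp add: drop_rev)
  then have drop_rev_xs: "continuant t (drop 2 (rev xs)) = continuant t (take (n - 1) xs)"
    by (simp add: continuant_rev_list)
  have tl_rev_xs: "continuant t (tl (rev xs)) = continuant t (butlast xs)"
    by (metis continuant_rev_list butlast_rev rev_rev_ident)
  note right = solution_continues_right[of n P d t C xs, OF assms(1,3,4) _ assms(7,8)]
  note left = solution_continues_right[of n P d t C "rev xs", OF assms(1,3,4) _ rev_sol rev_cop,
      unfolded reversed drop_rev_xs tl_rev_xs]
  show ?thesis
    by (intro conjI impI allI; (elim conjE)?; rule right left; (rule assms(6))?; assumption?)
qed

end
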